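(* Let $\lambda\in\mathbb{N}=\{1,2,\dots\}$ be fixed and let $(\widehat X'_i)_{i\ge1}$ be independent (not necessarily identically distributed) integer-valued random variables with $\widehat X'_i\ge-\lambda$ and PMFs $\widehat f'_i(k)=P(\widehat X'_i=k)$. For $n\ge1$ let $\widehat Y'_n=\sum_{i=1}^n\widehat X'_i$ and $\widehat Z'_n=\max_{1\le i\le n}\widehat X'_i$. Put $\widehat f_i(k)=\widehat f'_i(k-\lambda)$ for $k\in\mathbb{N}_0=\{0,1,\dots\}$ and $\widehat F_i(x)=\sum_{k=0}^{\lfloor x\rfloor}\widehat f_i(k)$ for $x\ge0$. Define $\widehat G_n$ on $[0,\infty)^2$ by $\widehat G_1(y,z)=\widehat F_1(\min(y,z))$ and, for $n\ge2$, $\widehat G_n(y,z)=\sum_{k=0}^{\min(\lfloor y\rfloor,\lfloor z\rfloor)}\widehat G_{n-1}(y-k,z)\widehat f_n(k)$ (with $\widehat G_n=0$ outside $[0,\infty)^2$). Define $\widehat g_n$ on $\widehat{\mathcal D}_n=\{(l,m)\in\mathbb{N}_0^2:m\le l\le nm\}$ by $\widehat g_1(l,m)=\widehat f_1(l)$ and, for $n\ge2$, $\widehat g_n(l,m)=\widehat f_n(m)\sum_{k=0}^m\widehat g_{n-1}(l-m,k)+\sum_{k=0}^{m-1}\widehat f_n(k)\widehat g_{n-1}(l-k,m)$ (with $\widehat g_n=0$ outside $\widehat{\mathcal D}_n$). Then for every $n\ge1$, all real $y,z$ and all integers $l,m$, $$P(\widehat Y'_n\le y,\ \widehat Z'_n\le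 z)=\widehat G_n(y+n\lambda,\ z+\lambda),\qquad P(\widehat Y'_n=l,\ \widehat Z'_n=m)=\widehat g_n(l+n\lambda,\ m+\lambda).$$
   Context: A sum whose upper limit is smaller than its lower limit equals $0$. *)

theory Defs
  imports "HOL-Probability.Probability"
begin

text \<open>Random variables are indexed from 1. PMF arguments, summation indices and lattice
  points are integers, so that a sum over \<open>{a..b}\<close> with \<open>b < a\<close> is \<open>0\<close>.\<close>

definition part_sum :: "(nat \<Rightarrow> 'a \<Rightarrow> int) \<Rightarrow> nat \<Rightarrow> 'a \<Rightarrow> int" where
  "part_sum X n \<omega> = (\<Sum>i=1..n. X i \<omega>)"

definition part_max :: "(nat \<Rightarrow> 'a \<Rightarrow> int) \<Rightarrow> nat \<Rightarrow> 'a \<Rightarrow> int" where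
  "part_max X n \<omega> = Max ((\<lambda>i. X i \<omega>) ` {1..n})"

definition pmf_of :: "'a measure \<Rightarrow> (nat \<Rightarrow> 'a \<Rightarrow> int) \<Rightarrow> nat \<Rightarrow> int \<Rightarrow> real" where
  "pmf_of M X i k = measure M {\<omega> \<in> space M. X i \<omega> = k}"

text \<open>Below, \<open>f i\<close> is only ever evaluated at nonnegative integers.\<close>

definition shift_pmf :: "nat \<Rightarrow> (nat \<Rightarrow> int \<Rightarrow> real) \<Rightarrow> nat \<Rightarrow> int \<Rightarrow> real" where
  "shift_pmf lam f' i k = f' i (k - int lam)"

definition F_hat :: "(nat \<Rightarrow> int \<Rightarrow> real) \<Rightarrow> nat \<Rightarrow> real \<Rightarrow> real" where
  "F_hat f i x = (\<Sum>k=0..\<lfloor>x\<rfloor>. f i k)"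

text \<open>The recursions start at \<open>n = 1\<close>; the value at \<open>n = 0\<close> is a dummy.\<close>

fun G_hat :: "(nat \<Rightarrow> int \<Rightarrow> real) \<Rightarrow> nat \<Rightarrow> real \<Rightarrow> real \<Rightarrow> real" where
  "G_hat f 0 y z = 0"
| "G_hat f (Suc 0) y z = (if 0 \<le> y \<and> 0 \<le> z then F_hat f 1 (min y z) else 0)"
| "G_hat f (Suc (Suc n)) y z =
     (if 0 \<le> y \<and> 0 \<le> z
      then \<Sum>k=0..min \<lfloor>y\<rfloor> \<lfloor>z\<rfloor>. G_hat f (Suc n) (y - real_of_int k) z * f (Suc (Suc n)) k
      else 0)"

definition D_hat :: "nat \<Rightarrow> (int \<times> int) set" where
  "D_hat n = {(l, m). 0 \<le> l \<and> 0 \<le> m \<and> m \<le> l \<and> l \<le> int n * m}"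

fun g_hat :: "(nat \<Rightarrow> int \<Rightarrow> real) \<Rightarrow> nat \<Rightarrow> int \<Rightarrow> int \<Rightarrow> real" where
  "g_hat f 0 l m = 0"
| "g_hat f (Suc 0) l m = (if (l, m) \<in> D_hat 1 then f 1 l else 0)"
| "g_hat f (Suc (Suc n)) l m =
     (if (l, m) \<in> D_hat (Suc (Suc n))
      then f (Suc (Suc n)) m * (\<Sum>k=0..m. g_hat f (Suc n) (l - m) k)
         + (\<Sum>k=0..m - 1. f (Suc (Suc n)) k * g_hat f (Suc n) (l - k) m)
      else 0)"

end

theory Submission
  imports Defs
begin

text \<open>Shifting every variable by \<open>\<lambda>\<close> makes it nonnegative almost surely. Conditioning the event
  that describes the sum and maximum of the first \<open>n + 1\<close> variables on the value of the last one,
  which is independent of the earlier ones and takes only finitely many relevant values, gives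
  exactly the recursions for \<open>G_hat\<close> and \<open>g_hat\<close>.\<close>

section \<open>Pointwise recursions, shifts and bounds for partial sums and maxima\<close>

lemma part_sum_0 [simp]: "part_sum X 0 \<omega> = 0"
  by (simp add: part_sum_def)

lemma part_max_1 [simp]: "part_max X (Suc 0) \<omega> = X 1 \<omega>"
  by (simp add: part_max_def)

lemma part_sum_Suc [simp]: "part_sum X (Suc n) \<omega> = part_sum X n \<omega> + X (Suc n) \<omega>"
  by (simp add: part_sum_def)

lemma part_max_Suc:
  assumes "1 \<le> n"
  shows "part_max X (Suc n) \<omega> = max (part_max X n \<omega>) (X (Suc n) \<omega>)"
proof -
  have "(\<lambda>i. X i \<omega>) ` {1..Suc n} = insert (X (Suc n) \<omega>) ((\<lambda>i. X i \<omega>) ` {1..n})"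
    by (simp add: atLeastAtMostSuc_conv)
  then show ?thesis
    using assms by (simp add: part_max_def max.commute)
qed

lemma part_sum_shift: "part_sum (\<lambda>i \<omega>. X i \<omega> + c) n \<omega> = part_sum X n \<omega> + int n * c"
  by (simp add: part_sum_def sum.distrib)

lemma part_max_shift:
  assumes "1 \<le> n"
  shows "part_max (\<lambda>i \<omega>. X i \<omega> + c) n \<omega> = part_max X n \<omega> + c"
  using assms by (induction n rule: nat_induct_at_least) (simp_all add: part_max_Suc)

text \<open>The only nontrivial bound is that a sum of \<open>n\<close> terms is at most
  \<open>n\<close> times their maximum. In the induction step the old maximum is replaced by the
  possibly larger new one, which also bounds the added term.\<close>

lemma part_sum_part_max_in_D_hat:
  assumes "1 \<le> n" "\<And>i. 1 \<le> i \<Longrightarrow> 0 \<le> W i \<omega>"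
  shows "(part_sum W n \<omega>, part_max W n \<omega>) \<in> D_hat n"
  using assms(1)
proof (induction n rule: nat_induct_at_least)
  case base
  then show ?case using assms(2)[of 1] by (simp add: D_hat_def)
next
  case (Suc n)
  have "0 \<le> W (Suc n) \<omega>" by (rule assms(2)) simp
  moreover have "int n * part_max W n \<omega> \<le> int n * max (part_max W n \<omega>) (W (Suc n) \<omega>)"
    by (rule mult_left_mono) auto
  then have "S + W (Suc n) \<omega> \<le> int (Suc n) * max (part_max W n \<omega>) (W (Suc n) \<omega>)"
    if "S \<le> int n * part_max W n \<omega>" for S
    using that by (simp add: distrib_right)
  ultimately show ?case
    using Suc by (auto simp: D_hat_def part_max_Suc simp del: of_nat_Suc)
qed

context prob_space
begin

text \<open>Total probability over finitely many values of \<open>V\<close>. Values outside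
  \<open>K\<close> are excluded only almost surely, so \<open>Q\<close> and the disjoint union of
  its slices agree up to a null set rather than as sets.\<close>

lemma prob_split_finite:
  fixes V :: "'a \<Rightarrow> 'b"
  assumes "finite K" "\<And>k. {\<omega> \<in> space M. V \<omega> = k \<and> Q \<omega>} \<in> events" "{\<omega> \<in> space M. Q \<omega>} \<in> events"
    and "AE \<omega> in M. Q \<omega> \<longrightarrow> V \<omega> \<in> K"
  shows "prob {\<omega> \<in> space M. Q \<omega>} = (\<Sum>k\<in>K. prob {\<omega> \<in> space M. V \<omega> = k \<and> Q \<omega>})"
proof -
  have "prob {\<omega> \<in> space M. Q \<omega>} = prob (\<Union>k\<in>K. {\<omega> \<in> space M. V \<omega> = k \<and> Q \<omega>})"
    using assms by (intro finite_measure_eq_AE) auto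
  also have "\<dots> = (\<Sum>k\<in>K. prob {\<omega> \<in> space M. V \<omega> = k \<and> Q \<omega>})"
    using assms by (intro finite_measure_finite_Union) (auto simp: disjoint_family_on_def)
  finally show ?thesis .
qed

end

section \<open>The recursions for independent, almost surely nonnegative variables\<close>

locale nonneg_indep = prob_space +
  fixes W :: "nat \<Rightarrow> 'a \<Rightarrow> int"
  assumes indep_W: "indep_vars (\<lambda>_. count_space UNIV) W {1..}"
    and nonneg_W: "\<And>i. 1 \<le> i \<Longrightarrow> AE \<omega> in M. 0 \<le> W i \<omega>"
begin

abbreviation "S \<equiv> part_sum W"
abbreviation "Z \<equiv> part_max W"
abbreviation "p \<equiv> pmf_of M W"

lemma measurable_W:
  assumes "1 \<le> i" shows "W i \<in> measurable M (count_space UNIV)"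
  using indep_W assms by (auto simp: indep_vars_def)

lemma measurable_S: "S n \<in> measurable M (count_space UNIV)"
proof (induction n)
  case 0
  then show ?case by (simp add: part_sum_def[abs_def])
next
  case (Suc n)
  note [measurable] = Suc measurable_W[of "Suc n", simplified]
  show ?case by (simp add: part_sum_Suc[abs_def])
qed

lemma measurable_Z:
  assumes "1 \<le> n" shows "Z n \<in> measurable M (count_space UNIV)"
  using assms
proof (induction n rule: nat_induct_at_least)
  case base
  show ?case using measurable_W[of 1] by (simp add: part_max_1[abs_def])
next
  case (Suc n)
  note [measurable] = Suc(2) measurable_W[of "Suc n", simplified]
  have eq: "Z (Suc n) = (\<lambda>\<omega>. max (Z n \<omega>) (W (Suc n) \<omega>))"
    using Suc by (auto simp: part_max_Suc)
  show ?case unfolding eq by measurable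
qed

text \<open>There are countably many indices, so one null set can be discarded outside of which all
  variables are nonnegative; there the pointwise bound applies.\<close>

lemma AE_D_hat:
  assumes "1 \<le> n"
  shows "AE \<omega> in M. (S n \<omega>, Z n \<omega>) \<in> D_hat n"
proof -
  have "AE \<omega> in M. \<forall>i\<in>{1..}. 0 \<le> W i \<omega>"
    using nonneg_W by (subst AE_ball_countable) auto
  then show ?thesis
    by eventually_elim (rule part_sum_part_max_in_D_hat[OF assms], simp)
qed

text \<open>\<open>S n\<close> and \<open>Z n\<close> are functions of the variables with index in
  \<open>{1..n}\<close>, a block disjoint from \<open>{Suc n}\<close>. Allowing an arbitrary
  relation \<open>R\<close> serves both the distribution function and the point masses.\<close>

lemma prob_last_indep:
  assumes "1 \<le> n"
  shows "prob {\<omega> \<in> space M. W (Suc n) \<omega> = k \<and> R (S n \<omega>) (Z n \<omega>)}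
    = p (Suc n) k * prob {\<omega> \<in> space M. R (S n \<omega>) (Z n \<omega>)}"
proof -
  let ?N = "\<lambda>I. PiM I (\<lambda>_::nat. count_space (UNIV :: int set))"
  let ?r = "\<lambda>I \<omega>. restrict (\<lambda>i. W i \<omega>) I"
  let ?C = "count_space (UNIV :: (int \<times> int) set)"
  \<comment> \<open>The truth value of \<open>R\<close> is coded as an integer because
    \<open>indep_var\<close> takes two variables of the same type.\<close>
  let ?ind = "\<lambda>g. of_bool (R (\<Sum>i=1..n. g i) (Max (g ` {1..n}))) :: int"
  \<comment> \<open>A finite product of these discrete spaces is discrete, so \<open>?ind\<close> is
    measurable whatever \<open>R\<close> is.\<close>
  have N: "?N I = count_space (PiE I (\<lambda>_. UNIV))" if "finite I" for I
    using that by (intro count_space_PiM_finite) auto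
  have "indep_var (?N {Suc n}) (?r {Suc n}) (?N {1..n}) (?r {1..n})"
    using assms by (intro indep_var_restrict[OF indep_W]) auto
  then have "indep_var (count_space UNIV) ((\<lambda>g. g (Suc n)) \<circ> ?r {Suc n})
      (count_space UNIV) (?ind \<circ> ?r {1..n})"
    by (rule indep_var_compose) (simp_all add: N)
  moreover have "(\<lambda>g. g (Suc n)) \<circ> ?r {Suc n} = W (Suc n)"
    by auto
  moreover have "?ind \<circ> ?r {1..n} = (\<lambda>\<omega>. of_bool (R (S n \<omega>) (Z n \<omega>)))"
  proof
    fix \<omega>
    have "?r {1..n} \<omega> ` {1..n} = (\<lambda>i. W i \<omega>) ` {1..n}"
      by (rule image_cong) auto
    then show "(?ind \<circ> ?r {1..n}) \<omega> = of_bool (R (S n \<omega>) (Z n \<omega>))"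
      by (simp add: part_sum_def part_max_def)
  qed
  ultimately have "indep_var (count_space UNIV) (W (Suc n))
      (count_space UNIV) (\<lambda>\<omega>. of_bool (R (S n \<omega>) (Z n \<omega>)) :: int)"
    by simp
  from indep_varD[OF this, of "{k}" "{1}"] show ?thesis
    by (simp add: pmf_of_def vimage_def Int_def conj_commute conj_left_commute)
qed

text \<open>Induction with \<open>y\<close> arbitrary and \<open>z\<close> fixed: fixing the last
  value at \<open>k\<close> lowers the bound on the sum by \<open>k\<close> and leaves that on the
  maximum.\<close>

lemma prob_eq_G_hat:
  assumes "1 \<le> n"
  shows "prob {\<omega> \<in> space M. real_of_int (S n \<omega>) \<le> y \<and> real_of_int (Z n \<omega>) \<le> z} = G_hat p n y z"
  using assms
proof (induction n arbitrary: y rule: nat_induct_at_least)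
  case base
  note [measurable] = measurable_W[of 1, simplified]
  have "AE \<omega> in M. real_of_int (W 1 \<omega>) \<le> y \<and> real_of_int (W 1 \<omega>) \<le> z \<longrightarrow> W 1 \<omega> \<in> {0..\<lfloor>min y z\<rfloor>}"
    using nonneg_W[of 1] by (auto simp: le_floor_iff)
  then have "prob {\<omega> \<in> space M. real_of_int (W 1 \<omega>) \<le> y \<and> real_of_int (W 1 \<omega>) \<le> z}
    = (\<Sum>k=0..\<lfloor>min y z\<rfloor>. prob {\<omega> \<in> space M. W 1 \<omega> = k \<and> real_of_int (W 1 \<omega>) \<le> y \<and> real_of_int (W 1 \<omega>) \<le> z})"
    by (intro prob_split_finite) auto
  also have "\<dots> = (\<Sum>k=0..\<lfloor>min y z\<rfloor>. p 1 k)"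
    by (intro sum.cong refl)
       (auto simp: pmf_of_def le_floor_iff intro!: arg_cong[of _ _ prob])
  also have "\<dots> = G_hat p 1 y z"
    by (auto simp: F_hat_def)
  finally show ?case by simp
next
  case (Suc n)
  let ?W = "W (Suc n)" and ?K = "{0..min \<lfloor>y\<rfloor> \<lfloor>z\<rfloor>}"
  let ?Q = "\<lambda>\<omega>. real_of_int (S (Suc n) \<omega>) \<le> y \<and> real_of_int (Z (Suc n) \<omega>) \<le> z"
  note [measurable] = measurable_W[of "Suc n", simplified] measurable_S[of n]
    measurable_S[of "Suc n"] measurable_Z[OF Suc(1)] measurable_Z[of "Suc n", simplified]
  \<comment> \<open>The last value is at most the new maximum, hence at most \<open>z\<close>; it is
    at most the new sum, hence at most \<open>y\<close>, because \<open>S n\<close> is almost surely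
    nonnegative.\<close>
  have "AE \<omega> in M. ?Q \<omega> \<longrightarrow> ?W \<omega> \<in> ?K"
    using nonneg_W[of "Suc n", simplified] AE_D_hat[OF Suc(1)]
    by eventually_elim (use Suc(1) in \<open>auto simp: D_hat_def part_max_Suc le_floor_iff\<close>)
  then have "prob {\<omega> \<in> space M. ?Q \<omega>} = (\<Sum>k\<in>?K. prob {\<omega> \<in> space M. ?W \<omega> = k \<and> ?Q \<omega>})"
    by (intro prob_split_finite) (auto simp del: part_sum_Suc)
  also have "\<dots> = (\<Sum>k\<in>?K. prob {\<omega> \<in> space M. ?W \<omega> = k \<and>
      (real_of_int (S n \<omega>) \<le> y - real_of_int k \<and> real_of_int (Z n \<omega>) \<le> z)})"
    using Suc(1)
    by (intro sum.cong refl arg_cong[of _ _ prob])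
       (auto simp: part_max_Suc le_floor_iff)
  also have "\<dots> = (\<Sum>k\<in>?K. G_hat p n (y - real_of_int k) z * p (Suc n) k)"
    by (simp add: Suc(2)[symmetric] mult.commute
        prob_last_indep[OF Suc(1), of _ "\<lambda>s t. real_of_int s \<le> y - real_of_int _ \<and> real_of_int t \<le> z"])
  also have "\<dots> = G_hat p (Suc n) y z"
  proof -
    obtain j where "n = Suc j" using Suc(1) by (cases n) auto
    \<comment> \<open>Outside the quadrant the empty sum agrees with the default value 0 of
      \<open>G_hat\<close>.\<close>
    moreover have "?K = {}" if "\<not> (0 \<le> y \<and> 0 \<le> z)" using that by (auto simp: le_floor_iff)
    ultimately show ?thesis by (auto simp del: atLeastatMost_empty_iff)
  qed
  finally show ?case .
qed

text \<open>Justifies the default value 0 of \<open>g_hat\<close> off its domain.\<close>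

lemma prob_outside_D_hat:
  assumes "1 \<le> n" "(l, m) \<notin> D_hat n"
  shows "prob {\<omega> \<in> space M. S n \<omega> = l \<and> Z n \<omega> = m} = 0"
proof -
  note [measurable] = measurable_S[of n] measurable_Z[OF assms(1)]
  have "prob {\<omega> \<in> space M. S n \<omega> = l \<and> Z n \<omega> = m} = prob {}"
    using AE_D_hat[OF assms(1)] assms(2)
    by (intro finite_measure_eq_AE) (auto elim!: eventually_mono)
  then show ?thesis by simp
qed

text \<open>The two terms of the recursion separate whether the last variable attains the maximum
  \<open>m\<close>: if so, the earlier maximum may be any value up to \<open>m\<close>; if not, it
  must equal \<open>m\<close>.\<close>

lemma prob_eq_g_hat:
  assumes "1 \<le> n"
  shows "prob {\<omega> \<in> space M. S n \<omega> = l \<and> Z n \<omega> = m} = g_hat p n l m"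
  using assms
proof (induction n arbitrary: l m rule: nat_induct_at_least)
  case base
  show ?case
  proof (cases "(l, m) \<in> D_hat 1")
    case True
    \<comment> \<open>\<open>D_hat 1\<close> lies on the diagonal \<open>l = m\<close>, so the two
      conditions on \<open>W 1\<close> coincide.\<close>
    then show ?thesis by (auto simp: D_hat_def pmf_of_def)
  next
    case False
    then show ?thesis using prob_outside_D_hat[of 1 l m] by simp
  qed
next
  case (Suc n)
  show ?case
  proof (cases "(l, m) \<in> D_hat (Suc n)")
    case False
    then show ?thesis
      using prob_outside_D_hat[of "Suc n" l m] Suc(1) by (cases n) (auto simp del: part_sum_Suc)
  next
    case True
    let ?W = "W (Suc n)"
    let ?Q = "\<lambda>\<omega>. S (Suc n) \<omega> = l \<and> Z (Suc n) \<omega> = m"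
    note [measurable] = measurable_W[of "Suc n", simplified] measurable_S[of n]
      measurable_S[of "Suc n"] measurable_Z[OF Suc(1)] measurable_Z[of "Suc n", simplified]
    have "0 \<le> m" using True by (simp add: D_hat_def)
    have less: "prob {\<omega> \<in> space M. ?W \<omega> = k \<and> ?Q \<omega>} = p (Suc n) k * g_hat p n (l - k) m"
      if "k \<in> {0..m - 1}" for k
    proof -
      have "{\<omega> \<in> space M. ?W \<omega> = k \<and> ?Q \<omega>} =
          {\<omega> \<in> space M. ?W \<omega> = k \<and> (S n \<omega> = l - k \<and> Z n \<omega> = m)}"
        using that Suc(1) by (auto simp: part_max_Suc max_def)
      then show ?thesis
        using prob_last_indep[OF Suc(1), of k "\<lambda>s t. s = l - k \<and> t = m"] Suc(2) by simp
    qed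
    \<comment> \<open>Splitting by the earlier maximum produces the inner sum of the first
      term.\<close>
    have "AE \<omega> in M. S n \<omega> = l - m \<and> Z n \<omega> \<le> m \<longrightarrow> Z n \<omega> \<in> {0..m}"
      using AE_D_hat[OF Suc(1)] by eventually_elim (auto simp: D_hat_def)
    then have "prob {\<omega> \<in> space M. S n \<omega> = l - m \<and> Z n \<omega> \<le> m} =
        (\<Sum>k=0..m. prob {\<omega> \<in> space M. Z n \<omega> = k \<and> (S n \<omega> = l - m \<and> Z n \<omega> \<le> m)})"
      by (intro prob_split_finite) auto
    also have "\<dots> = (\<Sum>k=0..m. g_hat p n (l - m) k)"
      by (intro sum.cong refl) (auto simp: Suc(2)[symmetric] intro!: arg_cong[of _ _ prob])
    finally have le: "prob {\<omega> \<in> space M. S n \<omega> = l - m \<and> Z n \<omega> \<le> m} = (\<Sum>k=0..m. g_hat p n (l - m) k)" .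
    have "{\<omega> \<in> space M. ?W \<omega> = m \<and> ?Q \<omega>} =
        {\<omega> \<in> space M. ?W \<omega> = m \<and> (S n \<omega> = l - m \<and> Z n \<omega> \<le> m)}"
      using Suc(1) by (auto simp: part_max_Suc max_def)
    then have eq: "prob {\<omega> \<in> space M. ?W \<omega> = m \<and> ?Q \<omega>} = p (Suc n) m * (\<Sum>k=0..m. g_hat p n (l - m) k)"
      using prob_last_indep[OF Suc(1), of m "\<lambda>s t. s = l - m \<and> t \<le> m"] le by simp
    have "AE \<omega> in M. ?Q \<omega> \<longrightarrow> ?W \<omega> \<in> {0..m}"
      using nonneg_W[of "Suc n", simplified]
      by eventually_elim (use Suc(1) in \<open>auto simp: part_max_Suc\<close>)
    then have "prob {\<omega> \<in> space M. ?Q \<omega>} = (\<Sum>k=0..m. prob {\<omega> \<in> space M. ?W \<omega> = k \<and> ?Q \<omega>})"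
      by (intro prob_split_finite) (auto simp del: part_sum_Suc)
    \<comment> \<open>The top value \<open>m\<close> is split off to match the two terms.\<close>
    also have "{0..m} = insert m {0..m - 1}"
      using \<open>0 \<le> m\<close> by auto
    also have "(\<Sum>k\<in>insert m {0..m - 1}. prob {\<omega> \<in> space M. ?W \<omega> = k \<and> ?Q \<omega>}) =
        p (Suc n) m * (\<Sum>k=0..m. g_hat p n (l - m) k) + (\<Sum>k=0..m - 1. p (Suc n) k * g_hat p n (l - k) m)"
      using less eq by (simp del: part_sum_Suc)
    also have "\<dots> = g_hat p (Suc n) l m"
      using True Suc(1) by (cases n) auto
    finally show ?thesis .
  qed
qed

end

theorem mainTheorem7:
  fixes M :: "'a measure"
    and X :: "nat \<Rightarrow> 'a \<Rightarrow> int"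
    and lam :: nat
    and f :: "nat \<Rightarrow> int \<Rightarrow> real"
  assumes "prob_space M"
    and "1 \<le> lam"
    and "prob_space.indep_vars M (\<lambda>_. count_space UNIV) X {1..}"
    and "\<And>i. 1 \<le> i \<Longrightarrow> AE \<omega> in M. - int lam \<le> X i \<omega>"
  defines "f \<equiv> shift_pmf lam (pmf_of M X)"
  shows "\<forall>n\<ge>1.
    (\<forall>y z :: real.
       measure M {\<omega> \<in> space M. real_of_int (part_sum X n \<omega>) \<le> y \<and> real_of_int (part_max X n \<omega>) \<le> z}
         = G_hat f n (y + real n * real lam) (z + real lam)) \<and>
    (\<forall>l m :: int.
       measure M {\<omega> \<in> space M. part_sum X n \<omega> = l \<and> part_max X n \<omega> = m}
         = g_hat f n (l + int n * int lam) (m + int lam))"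
proof -
  interpret prob_space M by (rule assms)
  let ?W = "\<lambda>i \<omega>. X i \<omega> + int lam"
  have "indep_vars (\<lambda>_. count_space UNIV) ?W {1..}"
    by (rule indep_vars_compose2[OF assms(3)]) auto
  moreover have "AE \<omega> in M. 0 \<le> ?W i \<omega>" if "1 \<le> i" for i
    using assms(4)[OF that] by eventually_elim simp
  ultimately interpret nonneg_indep M ?W
    by unfold_locales auto
  \<comment> \<open>\<open>X i + lam = k\<close> means \<open>X i = k - lam\<close>, so the shifted
    mass functions are those of \<open>?W\<close>.\<close>
  have f: "f = pmf_of M ?W"
    by (auto simp: f_def shift_pmf_def pmf_of_def fun_eq_iff algebra_simps)
  show ?thesis
    \<comment> \<open>The shift adds \<open>n * lam\<close> to the sum but only \<open>lam\<close>
      to the maximum, which gives the arguments of \<open>G_hat\<close> and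
      \<open>g_hat\<close>.\<close>
    unfolding f
    by (auto simp: prob_eq_G_hat[symmetric] prob_eq_g_hat[symmetric] part_sum_shift part_max_shift)
qed

end
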